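(* Let $<G(V,E,P),C,B>$ be an instance of the Budgeted Influence Maximization Problem with $n$ nodes and $m$ edges, whose detected community structure has $\ell$ communities, the largest having $n_{max}$ nodes. Consider the methodology that first computes approximate Shapley values by Algorithm A (with $\tau$ permutations and $\mathcal{R}$ repetitions) and then uses Algorithm M2 for seed set selection, both algorithms being as given in the context. Its running time is $\mathcal{O}(\tau\cdot n\cdot(m+n)\cdot\mathcal{R}+n\log n+\ell\log\ell+n\ell+\ell\,n_{max}\log n_{max})$ and its space requirement is $\mathcal{O}(n+\ell)$.
   Context: Instance: a social network $G(V,E,P)$ with node set $V(G)$, edge set $E(G)$ and influence probabilities $P:E(G)\to(0,1]$; a cost function $C:V(G)\to\mathbb{Z}^+$; a budget $B$. One seeks a seed set $S\subseteq V(G)$ with $C(S)=\sum_{u\in S}C(u)\le B$ maximizing the influence. $N(u)$ is the set of neighbours of $u$ and $\deg(u)$ its degree. For $S\subseteq V(G)$, $\nu(S)=\sigma(S)=\sum_{v\in V(G)}ap(v,S,MIIA(v,\theta))$ is the expected influence of $S$ in the Maximum Influence Arborescence (MIA) diffusion model. Here the propagation probability of a path is the product of the probabilities of its edges; $MIIA(v,\theta)$ is the union, over all $u\neq v$, of those maximum-probability paths from $u$ to $v$ whose propagation probability is at least a cut-off $\theta$; and $ap(v,S,MIIA(v,\theta))$ is the probability that $v$ is influenced by $S$ when influence travels to $v$ only through $MIIA(v,\theta)$. Algorithm A (approximate Shapley values). Input: the instance, error $\epsilon$, probability $\delta$, range of marginal contribution $r$, and the number of repetitions $\mathcal{R}$.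 1. For each $u\in V(G)$: $b_u\leftarrow 0$; $c_u\leftarrow\frac{\deg(u)}{2}+\sum_{w\in N(u)}\frac{1}{\deg(w)-1}$. 2. $r=\frac1n\sum_{u\in V(G)}c_u$. 3. Generate $\tau\ge\lceil\ln(2/\delta)\,r^2/(2\epsilon^2)\rceil$ permutations $p_1,\dots,p_\tau$ of the nodes. 4. Create arrays $\phi$ and $MG$ of size $n$, initialized with $0$. 5. For $i=1$ to $\tau$: { for each $u\in V(G)$ set $T(u)=0$; for $j=1$ to $\mathcal{R}$: { for each $u\in V(G)$: $T(u)=T(u)+\nu(S_u(p_i)\cup\{u\})-\nu(S_u(p_i))$, where $S_u(p_i)$ is the set of nodes appearing before $u$ in $p_i$; then $MG(u)=T(u)/\mathcal{R}$ } }. 6. For each $u\in V(G)$: $\phi(u)=MG(u)/\tau$. Return $\phi$. Algorithm M2 (Method 2). Input: the instance and $\phi$. 1. Detect the community structure of the network (by the Louvain algorithm), stored in an array $Community$ giving each node's community number; let $K=\{K_1,\dots,K_\ell\}$ be the communities; sort $K$; let $K_{max}$ be the largest community. 2. Compute $Total=\sum_{u\in V(G)}\phi(u)$. Create an array $B_K$ with all entries $0$. 3. For $i=1$ to $\ell$: compute $Temp=\sum_{u\in V(K_i)}\phi(u)$ and set $B_{K_i}\leftarrow\frac{Temp}{Total}\cdot B$. 4. $S\leftarrow\emptyset$. 5. For $i=1$ to $\ell$: { sort the nodes of $V(K_i)$ based on the values in $\phi$, giving $u_1,u_2,\dots$; for $j=1$ to $|V(K_i)|$: { while $B_{K_i}\ge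 0$: { if $B_{K_i}\ge C(u_j)$, then $S\leftarrow S\cup\{u_j\}$ and $B_{K_i}\leftarrow B_{K_i}-C(u_j)$ } }; then $B_{K_{max}}\leftarrow B_{K_{max}}+B_{K_i}$ }. 6. Return $S$. Cost assumptions: all degrees are computed in $\mathcal{O}(n^2)$ time; the marginal contribution of a node is computed by traversing the graph in $\mathcal{O}(m+n)$ time; community detection by the Louvain algorithm takes $\mathcal{O}(n\log n)$ time; space means the extra space consumed.
   Formalization: The while-test B_{K_i} ≥ 0 in Algorithm M2 is made once per node, as literally it never ends; permutations are generated one at a time, since storing all τ needs τn space; working space of marginal-contribution and Louvain subroutines is assumed O(n); 1/(deg(w)-1) is 0 if deg(w)=1. *)

theory Defs
  imports Complex_Main "HOL-Library.Landau_Symbols"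
begin

section \<open>Instances and the MIA diffusion model\<close>

text \<open>
  The nodes are numbered, V = {0..<n}. An arc (u, v) carries the probability that u influences v;
  an undirected network is the special case of a symmetric arc set.
\<close>

record bim_instance =
  n_nodes :: nat
  arcs :: "(nat \<times> nat) set"
  prob :: "nat \<times> nat \<Rightarrow> real"
  cost :: "nat \<Rightarrow> nat"
  budget :: real
  cutoff :: real

definition nodes :: "'a bim_instance_scheme \<Rightarrow> nat set" where
  "nodes G = {..<n_nodes G}"

definition bim_instance :: "'a bim_instance_scheme \<Rightarrow> bool" where
  "bim_instance G \<longleftrightarrow>
     n_nodes G \<ge> 1 \<and>
     arcs G \<subseteq> nodes G \<times> nodes G \<and> (\<forall>u. (u, u) \<notin> arcs G) \<and>
     (\<forall>e \<in> arcs G. 0 < prob G e \<and> prob G e \<le> 1) \<and>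
     (\<forall>u \<in> nodes G. 0 < cost G u) \<and>
     0 \<le> budget G"

definition adjacent :: "'a bim_instance_scheme \<Rightarrow> nat \<Rightarrow> nat \<Rightarrow> bool" where
  "adjacent G u w \<longleftrightarrow> (u, w) \<in> arcs G \<or> (w, u) \<in> arcs G"

definition neighbours :: "'a bim_instance_scheme \<Rightarrow> nat \<Rightarrow> nat set" where
  "neighbours G u = {w \<in> nodes G. adjacent G u w}"

definition degree :: "'a bim_instance_scheme \<Rightarrow> nat \<Rightarrow> nat" where
  "degree G u = card (neighbours G u)"

definition path_arcs :: "nat list \<Rightarrow> (nat \<times> nat) list" where
  "path_arcs p = zip p (tl p)"

definition path_between :: "'a bim_instance_scheme \<Rightarrow> nat \<Rightarrow> nat \<Rightarrow> nat list \<Rightarrow> bool" where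
  "path_between G u v p \<longleftrightarrow>
     p \<noteq> [] \<and> hd p = u \<and> last p = v \<and> distinct p \<and> set (path_arcs p) \<subseteq> arcs G"

definition path_prob :: "'a bim_instance_scheme \<Rightarrow> nat list \<Rightarrow> real" where
  "path_prob G p = prod_list (map (prob G) (path_arcs p))"

definition max_influence_path :: "'a bim_instance_scheme \<Rightarrow> nat \<Rightarrow> nat \<Rightarrow> nat list \<Rightarrow> bool" where
  "max_influence_path G u v p \<longleftrightarrow>
     path_between G u v p \<and> (\<forall>q. path_between G u v q \<longrightarrow> path_prob G q \<le> path_prob G p)"

definition MIIA :: "'a bim_instance_scheme \<Rightarrow> nat \<Rightarrow> (nat \<times> nat) set" where
  "MIIA G v =
     \<Union> {set (path_arcs p) | p u. u \<in> nodes G \<and> u \<noteq> v \<and>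
          max_influence_path G u v p \<and> cutoff G \<le> path_prob G p}"

text \<open>
  The arcs of A are live independently, each with its own probability; v is influenced by S iff
  some seed reaches v (or is v) along live arcs of A. The sum runs over the set L of live arcs.
\<close>

definition ap :: "'a bim_instance_scheme \<Rightarrow> nat \<Rightarrow> nat set \<Rightarrow> (nat \<times> nat) set \<Rightarrow> real" where
  "ap G v S A =
     (\<Sum>L \<in> Pow A. (\<Prod>e\<in>L. prob G e) * (\<Prod>e\<in>A - L. 1 - prob G e) *
        of_bool (\<exists>s\<in>S. (s, v) \<in> L\<^sup>*))"

definition influence :: "'a bim_instance_scheme \<Rightarrow> nat set \<Rightarrow> real" where
  "influence G S = (\<Sum>v \<in> nodes G. ap G v S (MIIA G v))"

definition marginal_contribution :: "'a bim_instance_scheme \<Rightarrow> nat set \<Rightarrow> nat \<Rightarrow> real" where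
  "marginal_contribution G S u = influence G (insert u S) - influence G S"


section \<open>Runs of the methodology\<close>

text \<open>
  A run consists of an instance, the parameters of the two algorithms, the outcome of the random
  draws, the communities reported by the detection subroutine, and the time and working space
  spent by the two subroutines that are not spelled out below: the evaluation of the marginal
  contribution of u to S, and community detection.
  The value draw x i k, an element of {0..k}, is the k-th draw made for the i-th permutation.
\<close>

record run = bim_instance +
  eps :: real
  delta :: real
  tau :: nat
  reps :: nat
  draw :: "nat \<Rightarrow> nat \<Rightarrow> nat"
  community :: "nat \<Rightarrow> nat"
  marginal_time :: "nat set \<Rightarrow> nat \<Rightarrow> nat"
  marginal_space :: "nat set \<Rightarrow> nat \<Rightarrow> nat"
  louvain_time :: nat
  louvain_space :: nat

text \<open>Division by zero yields 0, so leaves w (degree 1) contribute nothing to the inner sum.\<close>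

definition mc_bound :: "'a bim_instance_scheme \<Rightarrow> nat \<Rightarrow> real" where
  "mc_bound G u =
     real (degree G u) / 2 + (\<Sum>w \<in> neighbours G u. 1 / (real (degree G w) - 1))"

definition mc_range :: "'a bim_instance_scheme \<Rightarrow> real" where
  "mc_range G = (\<Sum>u \<in> nodes G. mc_bound G u) / real (n_nodes G)"

definition n_comms :: "run \<Rightarrow> nat" where
  "n_comms x = card (community x ` nodes x)"

definition comm_nodes :: "run \<Rightarrow> nat \<Rightarrow> nat set" where
  "comm_nodes x k = {u \<in> nodes x. community x u = k}"

definition n_max :: "run \<Rightarrow> nat" where
  "n_max x = Max ((\<lambda>k. card (comm_nodes x k)) ` {..<n_comms x})"

definition n_arcs :: "run \<Rightarrow> nat" where
  "n_arcs x = card (arcs x)"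

definition valid_run :: "run \<Rightarrow> bool" where
  "valid_run x \<longleftrightarrow>
     bim_instance x \<and>
     0 < eps x \<and> 0 < delta x \<and> delta x < 1 \<and>
     1 \<le> tau x \<and> 1 \<le> reps x \<and>
     \<lceil>ln (2 / delta x) * (mc_range x)\<^sup>2 / (2 * (eps x)\<^sup>2)\<rceil> \<le> int (tau x) \<and>
     (\<forall>i k. draw x i k \<le> k) \<and>
     community x ` nodes x = {..<n_comms x}"

definition worst_marginal_time :: "run \<Rightarrow> nat" where
  "worst_marginal_time x = Max {marginal_time x S u | S u. S \<subseteq> nodes x \<and> u \<in> nodes x}"

definition worst_marginal_space :: "run \<Rightarrow> nat" where
  "worst_marginal_space x = Max {marginal_space x S u | S u. S \<subseteq> nodes x \<and> u \<in> nodes x}"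


section \<open>A real RAM with arrays\<close>

text \<open>
  The store maps names to arrays of reals; an unallocated name has the empty array, and a scalar
  variable is an array of length 1. Numbers of nodes, communities and positions are stored as reals.
  Read-only input (adjacency, costs, random draws) is accessed through unit-cost operators and
  is not part of the store, so the space measured here is extra space.
\<close>

type_synonym store = "string \<Rightarrow> real list"

definition store_size :: "store \<Rightarrow> nat" where
  "store_size s = (\<Sum>a | s a \<noteq> []. length (s a))"

definition index :: "real \<Rightarrow> nat" where
  "index r = nat \<lfloor>r\<rfloor>"

definition read :: "store \<Rightarrow> string \<Rightarrow> nat \<Rightarrow> real" where
  "read s a i = (if i < length (s a) then s a ! i else 0)"

datatype exp =
    Num real
  | Var string
  | Get string exp
  | Op1 "real \<Rightarrow> real" exp
  | Op2 "real \<Rightarrow> real \<Rightarrow> real" exp exp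

primrec eval_exp :: "exp \<Rightarrow> store \<Rightarrow> real" where
  "eval_exp (Num r) s = r"
| "eval_exp (Var x) s = read s x 0"
| "eval_exp (Get a e) s = read s a (index (eval_exp e s))"
| "eval_exp (Op1 f e) s = f (eval_exp e s)"
| "eval_exp (Op2 f e1 e2) s = f (eval_exp e1 s) (eval_exp e2 s)"

primrec exp_time :: "exp \<Rightarrow> nat" where
  "exp_time (Num r) = 1"
| "exp_time (Var x) = 1"
| "exp_time (Get a e) = exp_time e + 1"
| "exp_time (Op1 f e) = exp_time e + 1"
| "exp_time (Op2 f e1 e2) = exp_time e1 + exp_time e2 + 1"

text \<open>
  A condition holds iff its value is nonzero. \<open>Call f\<close> is a subroutine: f yields the store
  after the call, the time taken and the working space needed in addition to the store.
\<close>

datatype com =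
    Skip
  | Assign string exp               ("_ ::= _" [1000, 61] 61)
  | Put string exp exp              ("_ \<lbrakk>_\<rbrakk> ::= _" [1000, 0, 61] 61)
  | Alloc string exp
  | Seq com com                     ("_;;/ _" [60, 61] 60)
  | Cond exp com com                ("(IF _/ THEN _/ ELSE _)" [0, 0, 61] 61)
  | For string exp com              ("(FOR _ BELOW _/ DO _)" [1000, 0, 61] 61)
  | Call "store \<Rightarrow> store \<times> nat \<times> nat"

record config =
  mem :: store
  steps :: nat
  peak :: nat

definition advance :: "nat \<Rightarrow> store \<Rightarrow> config \<Rightarrow> config" where
  "advance t s \<sigma> = \<lparr>mem = s, steps = steps \<sigma> + t, peak = max (peak \<sigma>) (store_size s)\<rparr>"

text \<open>\<open>FOR x BELOW e DO c\<close> evaluates e once, to k say, and runs c for x = 0, ..., k - 1.\<close>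

primrec exec :: "com \<Rightarrow> config \<Rightarrow> config" where
  "exec Skip \<sigma> = advance 1 (mem \<sigma>) \<sigma>"
| "exec (x ::= e) \<sigma> =
     advance (exp_time e + 1) ((mem \<sigma>)(x := [eval_exp e (mem \<sigma>)])) \<sigma>"
| "exec (a \<lbrakk>i\<rbrakk> ::= e) \<sigma> =
     advance (exp_time i + exp_time e + 1)
       ((mem \<sigma>)(a := (mem \<sigma> a)[index (eval_exp i (mem \<sigma>)) := eval_exp e (mem \<sigma>)])) \<sigma>"
| "exec (Alloc a e) \<sigma> =
     advance (exp_time e + index (eval_exp e (mem \<sigma>)) + 1)
       ((mem \<sigma>)(a := replicate (index (eval_exp e (mem \<sigma>))) 0)) \<sigma>"
| "exec (c1;; c2) \<sigma> = exec c2 (exec c1 \<sigma>)"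
| "exec (IF b THEN c1 ELSE c2) \<sigma> =
     (if eval_exp b (mem \<sigma>) \<noteq> 0
      then exec c1 (advance (exp_time b + 1) (mem \<sigma>) \<sigma>)
      else exec c2 (advance (exp_time b + 1) (mem \<sigma>) \<sigma>))"
| "exec (FOR x BELOW e DO c) \<sigma> =
     fold (\<lambda>k \<sigma>. exec c (advance 1 ((mem \<sigma>)(x := [real k])) \<sigma>))
       [0..<index (eval_exp e (mem \<sigma>))]
       (advance (exp_time e + 1) (mem \<sigma>) \<sigma>)"
| "exec (Call f) \<sigma> =
     (case f (mem \<sigma>) of (s, t, w) \<Rightarrow>
        \<lparr>mem = s, steps = steps \<sigma> + t + 1,
         peak = max (peak \<sigma>) (max (store_size (mem \<sigma>)) (store_size s) + w)\<rparr>)"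

definition initial :: config where
  "initial = \<lparr>mem = (\<lambda>a. []), steps = 0, peak = 0\<rparr>"

definition running_time :: "com \<Rightarrow> nat" where
  "running_time c = steps (exec c initial)"

definition space_used :: "com \<Rightarrow> nat" where
  "space_used c = peak (exec c initial)"

abbreviation plus_e (infixl "\<oplus>" 65) where "a \<oplus> b \<equiv> Op2 (+) a b"
abbreviation minus_e (infixl "\<ominus>" 65) where "a \<ominus> b \<equiv> Op2 (-) a b"
abbreviation times_e (infixl "\<otimes>" 70) where "a \<otimes> b \<equiv> Op2 (*) a b"
abbreviation divide_e (infixl "\<oslash>" 70) where "a \<oslash> b \<equiv> Op2 (/) a b"
abbreviation min_e where "min_e a b \<equiv> Op2 min a b"
abbreviation le_e (infix "\<preceq>" 50) where "a \<preceq> b \<equiv> Op2 (\<lambda>r s. of_bool (r \<le> s)) a b"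
abbreviation less_e (infix "\<prec>" 50) where "a \<prec> b \<equiv> Op2 (\<lambda>r s. of_bool (r < s)) a b"
abbreviation eq_e (infix "\<doteq>" 50) where "a \<doteq> b \<equiv> Op2 (\<lambda>r s. of_bool (r = s)) a b"

abbreviation num :: "nat \<Rightarrow> exp" where "num k \<equiv> Num (real k)"

abbreviation adjacent_e :: "run \<Rightarrow> exp \<Rightarrow> exp \<Rightarrow> exp" where
  "adjacent_e x \<equiv> Op2 (\<lambda>u w. of_bool (adjacent x (index u) (index w)))"
abbreviation cost_e :: "run \<Rightarrow> exp \<Rightarrow> exp" where
  "cost_e x \<equiv> Op1 (\<lambda>u. real (cost x (index u)))"
abbreviation draw_e :: "run \<Rightarrow> exp \<Rightarrow> exp \<Rightarrow> exp" where
  "draw_e x \<equiv> Op2 (\<lambda>i k. real (draw x (index i) (index k)))"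


section \<open>Approximate Shapley values\<close>

definition bounds_com :: "run \<Rightarrow> com" where
  "bounds_com x =
     Alloc ''deg'' (num (n_nodes x));;
     Alloc ''b'' (num (n_nodes x));;
     Alloc ''c'' (num (n_nodes x));;
     FOR ''u'' BELOW num (n_nodes x) DO
       FOR ''w'' BELOW num (n_nodes x) DO
         (IF adjacent_e x (Var ''u'') (Var ''w'')
          THEN ''deg''\<lbrakk>Var ''u''\<rbrakk> ::= Get ''deg'' (Var ''u'') \<oplus> Num 1
          ELSE Skip);;
     FOR ''u'' BELOW num (n_nodes x) DO
       (''b''\<lbrakk>Var ''u''\<rbrakk> ::= Num 0;;
        ''c''\<lbrakk>Var ''u''\<rbrakk> ::= Get ''deg'' (Var ''u'') \<oslash> Num 2;;
        FOR ''w'' BELOW num (n_nodes x) DO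
          (IF adjacent_e x (Var ''u'') (Var ''w'')
           THEN ''c''\<lbrakk>Var ''u''\<rbrakk> ::=
             Get ''c'' (Var ''u'') \<oplus> Num 1 \<oslash> (Get ''deg'' (Var ''w'') \<ominus> Num 1)
           ELSE Skip));;
     ''r'' ::= Num 0;;
     FOR ''u'' BELOW num (n_nodes x) DO
       ''r'' ::= Var ''r'' \<oplus> Get ''c'' (Var ''u'');;
     ''r'' ::= Var ''r'' \<oslash> num (n_nodes x)"

text \<open>
  The i-th random permutation, by the inside-out form of the Fisher-Yates shuffle. Every
  permutation of the nodes arises from exactly one admissible choice of draws. It overwrites its
  predecessor: keeping all tau permutations would take tau * n cells.
\<close>

definition permutation_com :: "run \<Rightarrow> com" where
  "permutation_com x =
     FOR ''k'' BELOW num (n_nodes x) DO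
       (''h'' ::= draw_e x (Var ''i'') (Var ''k'');;
        ''p''\<lbrakk>Var ''k''\<rbrakk> ::= Get ''p'' (Var ''h'');;
        ''p''\<lbrakk>Var ''h''\<rbrakk> ::= Var ''k'')"

text \<open>The set of nodes before u in the current permutation, as an array of flags.\<close>

definition predecessors_com :: "run \<Rightarrow> com" where
  "predecessors_com x =
     FOR ''k'' BELOW num (n_nodes x) DO
       (''pre''\<lbrakk>Var ''k''\<rbrakk> ::= Num 0);;
     ''found'' ::= Num 0;;
     FOR ''k'' BELOW num (n_nodes x) DO
       (IF Var ''found'' \<doteq> Num 0
        THEN (IF Get ''p'' (Var ''k'') \<doteq> Var ''u''
              THEN ''found'' ::= Num 1
              ELSE ''pre''\<lbrakk>Get ''p'' (Var ''k'')\<rbrakk> ::= Num 1)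
        ELSE Skip)"

definition flagged :: "run \<Rightarrow> store \<Rightarrow> string \<Rightarrow> nat set" where
  "flagged x s a = {w \<in> nodes x. read s a w \<noteq> 0}"

definition marginal_call :: "run \<Rightarrow> store \<Rightarrow> store \<times> nat \<times> nat" where
  "marginal_call x s =
     (let S = flagged x s ''pre''; u = index (read s ''u'' 0) in
        (s(''mc'' := [marginal_contribution x S u]), marginal_time x S u, marginal_space x S u))"

definition shapley_com :: "run \<Rightarrow> com" where
  "shapley_com x =
     bounds_com x;;
     Alloc ''phi'' (num (n_nodes x));;
     Alloc ''MG'' (num (n_nodes x));;
     Alloc ''T'' (num (n_nodes x));;
     Alloc ''p'' (num (n_nodes x));;
     Alloc ''pre'' (num (n_nodes x));;
     FOR ''i'' BELOW num (tau x) DO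
       (permutation_com x;;
        FOR ''u'' BELOW num (n_nodes x) DO
          (''T''\<lbrakk>Var ''u''\<rbrakk> ::= Num 0);;
        FOR ''j'' BELOW num (reps x) DO
          FOR ''u'' BELOW num (n_nodes x) DO
            (predecessors_com x;;
             Call (marginal_call x);;
             ''T''\<lbrakk>Var ''u''\<rbrakk> ::= Get ''T'' (Var ''u'') \<oplus> Var ''mc'';;
             ''MG''\<lbrakk>Var ''u''\<rbrakk> ::= Get ''T'' (Var ''u'') \<oslash> num (reps x)));;
     FOR ''u'' BELOW num (n_nodes x) DO
       (''phi''\<lbrakk>Var ''u''\<rbrakk> ::= Get ''MG'' (Var ''u'') \<oslash> num (tau x))"


section \<open>Seed set selection\<close>

definition louvain_call :: "run \<Rightarrow> store \<Rightarrow> store \<times> nat \<times> nat" where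
  "louvain_call x s =
     (s(''Community'' := map (\<lambda>u. real (community x u)) [0..<n_nodes x],
        ''l'' := [real (n_comms x)]),
      louvain_time x, louvain_space x)"

text \<open>
  Bottom-up merge sort of the first len entries of the array a by increasing key. Runs of width
  w are merged pairwise into the array tmp: i and j point into the two runs, which end at
  mid and hi. The width is doubled until it reaches len.
\<close>

definition merge_sort_com :: "string \<Rightarrow> exp \<Rightarrow> (exp \<Rightarrow> exp) \<Rightarrow> com" where
  "merge_sort_com a len key =
     (let take_left = (''tmp''\<lbrakk>Var ''q''\<rbrakk> ::= Get a (Var ''li'');; ''li'' ::= Var ''li'' \<oplus> Num 1);
          take_right = (''tmp''\<lbrakk>Var ''q''\<rbrakk> ::= Get a (Var ''ri'');; ''ri'' ::= Var ''ri'' \<oplus> Num 1)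
      in
        Alloc ''tmp'' len;;
        ''width'' ::= Num 1;;
        FOR ''pass'' BELOW len DO
          (IF Var ''width'' \<prec> len
           THEN
             (''hi'' ::= Num 0;;
              FOR ''q'' BELOW len DO
                ((IF Var ''q'' \<doteq> Var ''hi''
                  THEN
                    (''li'' ::= Var ''q'';;
                     ''mid'' ::= min_e (Var ''q'' \<oplus> Var ''width'') len;;
                     ''ri'' ::= Var ''mid'';;
                     ''hi'' ::= min_e (Var ''mid'' \<oplus> Var ''width'') len)
                  ELSE Skip);;
                 (IF Var ''li'' \<prec> Var ''mid''
                  THEN
                    (IF Var ''ri'' \<prec> Var ''hi''
                     THEN (IF key (Get a (Var ''li'')) \<preceq> key (Get a (Var ''ri''))
                           THEN take_left ELSE take_right)
                     ELSE take_left)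
                  ELSE take_right));;
              FOR ''q'' BELOW len DO
                (a\<lbrakk>Var ''q''\<rbrakk> ::= Get ''tmp'' (Var ''q''));;
              ''width'' ::= Num 2 \<otimes> Var ''width'')
           ELSE Skip))"

text \<open>
  The communities are sorted by increasing size, so that the largest one, to which unspent
  budget is passed on, is processed last. The array ord lists the community numbers in this order.
\<close>

definition communities_com :: "run \<Rightarrow> com" where
  "communities_com x =
     Call (louvain_call x);;
     Alloc ''size'' (Var ''l'');;
     FOR ''u'' BELOW num (n_nodes x) DO
       (''size''\<lbrakk>Get ''Community'' (Var ''u'')\<rbrakk> ::=
          Get ''size'' (Get ''Community'' (Var ''u'')) \<oplus> Num 1);;
     Alloc ''ord'' (Var ''l'');;
     FOR ''i'' BELOW Var ''l'' DO
       (''ord''\<lbrakk>Var ''i''\<rbrakk> ::= Var ''i'');;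
     merge_sort_com ''ord'' (Var ''l'') (Get ''size'');;
     ''kmax'' ::= Get ''ord'' (Var ''l'' \<ominus> Num 1)"

definition budgets_com :: "run \<Rightarrow> com" where
  "budgets_com x =
     ''Total'' ::= Num 0;;
     FOR ''u'' BELOW num (n_nodes x) DO
       (''Total'' ::= Var ''Total'' \<oplus> Get ''phi'' (Var ''u''));;
     Alloc ''BK'' (Var ''l'');;
     FOR ''i'' BELOW Var ''l'' DO
       (''k'' ::= Get ''ord'' (Var ''i'');;
        ''Temp'' ::= Num 0;;
        FOR ''u'' BELOW num (n_nodes x) DO
          (IF Get ''Community'' (Var ''u'') \<doteq> Var ''k''
           THEN ''Temp'' ::= Var ''Temp'' \<oplus> Get ''phi'' (Var ''u'')
           ELSE Skip);;
        ''BK''\<lbrakk>Var ''k''\<rbrakk> ::= Var ''Temp'' \<oslash> Var ''Total'' \<otimes> Num (budget x))"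

text \<open>
  The guard 0 \<le> BK[k] is tested once per node: repeating the test until it fails would
  never end, because BK[k] is only decreased when it stays nonnegative.
\<close>

definition selection_com :: "run \<Rightarrow> com" where
  "selection_com x =
     Alloc ''S'' (num (n_nodes x));;
     FOR ''i'' BELOW Var ''l'' DO
       (''k'' ::= Get ''ord'' (Var ''i'');;
        Alloc ''L'' (Get ''size'' (Var ''k''));;
        ''cnt'' ::= Num 0;;
        FOR ''u'' BELOW num (n_nodes x) DO
          (IF Get ''Community'' (Var ''u'') \<doteq> Var ''k''
           THEN (''L''\<lbrakk>Var ''cnt''\<rbrakk> ::= Var ''u'';; ''cnt'' ::= Var ''cnt'' \<oplus> Num 1)
           ELSE Skip);;
        merge_sort_com ''L'' (Var ''cnt'') (\<lambda>e. Num 0 \<ominus> Get ''phi'' e);;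
        FOR ''j'' BELOW Var ''cnt'' DO
          (''v'' ::= Get ''L'' (Var ''j'');;
           (IF Num 0 \<preceq> Get ''BK'' (Var ''k'')
            THEN
              (IF cost_e x (Var ''v'') \<preceq> Get ''BK'' (Var ''k'')
               THEN
                 (''S''\<lbrakk>Var ''v''\<rbrakk> ::= Num 1;;
                  ''BK''\<lbrakk>Var ''k''\<rbrakk> ::= Get ''BK'' (Var ''k'') \<ominus> cost_e x (Var ''v''))
               ELSE Skip)
            ELSE Skip));;
        ''BK''\<lbrakk>Var ''kmax''\<rbrakk> ::= Get ''BK'' (Var ''kmax'') \<oplus> Get ''BK'' (Var ''k''))"

definition seed_selection_com :: "run \<Rightarrow> com" where
  "seed_selection_com x = communities_com x;; budgets_com x;; selection_com x"

definition methodology :: "run \<Rightarrow> com" where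
  "methodology x = shapley_com x;; seed_selection_com x"

end

theory Submission
  imports Defs
begin

text \<open>
  Hoare triples that carry a bound on time and space are composed along the program. Sorting need
  not be shown correct: for every value k, at most n_max nodes carry the community number k, so each
  list built in the selection phase is short, and merge sort makes a full pass only while the run
  width, which doubles, is below the length. The space is linear because there are boundedly many
  arrays, each of length at most n.
\<close>

section \<open>A Hoare logic for time and space\<close>

lemma index_real [simp]: "index (real k) = k"
  by (simp add: index_def)

text \<open>Every variable of the programs has a name of at most 9 characters, and there are finitely
  many such names.\<close>

definition short_names :: "string set" where
  "short_names = {a. length a \<le> 9}"

lemma finite_short_names: "finite short_names"
  using finite_lists_length_le[of "UNIV :: char set" 9] by (simp add: short_names_def)

definition keeps :: "(store \<Rightarrow> bool) \<Rightarrow> string \<Rightarrow> bool" where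
  "keeps P a \<longleftrightarrow> (\<forall>s r. P s \<longrightarrow> P (s(a := r)))"

lemma keepsD: "keeps P a \<Longrightarrow> P s \<Longrightarrow> P (s(a := r))"
  by (simp add: keeps_def)

locale space_bound =
  fixes n extra :: nat
  assumes n_pos: "1 \<le> n"
begin

definition fits :: "store \<Rightarrow> bool" where
  "fits s \<longleftrightarrow> (\<forall>a. length (s a) \<le> (if a \<in> short_names then n else 0))"

definition space :: nat where
  "space = card short_names * n + extra"

lemma store_size_le:
  assumes "fits s"
  shows "store_size s \<le> card short_names * n"
proof -
  have sub: "{a. s a \<noteq> []} \<subseteq> short_names"
    using assms by (auto simp: fits_def split: if_splits)
  have "store_size s \<le> (\<Sum>a \<in> short_names. length (s a))"
    unfolding store_size_def by (rule sum_mono2[OF finite_short_names sub]) simp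
  also have "\<dots> \<le> (\<Sum>a \<in> short_names. n)"
    using assms by (intro sum_mono) (auto simp: fits_def split: if_splits)
  finally show ?thesis by simp
qed

lemma store_size_space: "fits s \<Longrightarrow> store_size s \<le> space"
  using store_size_le[of s] by (simp add: space_def)

lemma fits_upd: "fits s \<Longrightarrow> length r \<le> n \<Longrightarrow> a \<in> short_names \<Longrightarrow> fits (s(a := r))"
  by (auto simp: fits_def split: if_splits)

lemma fits_put: "fits s \<Longrightarrow> fits (s(a := (s a)[i := r]))"
  by (auto simp: fits_def split: if_splits)

definition triple :: "(store \<Rightarrow> bool) \<Rightarrow> com \<Rightarrow> nat \<Rightarrow> (store \<Rightarrow> bool) \<Rightarrow> bool" where
  "triple P c t Q \<longleftrightarrow>
     (\<forall>\<sigma>. fits (mem \<sigma>) \<and> P (mem \<sigma>) \<and> peak \<sigma> \<le> space \<longrightarrow>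
        fits (mem (exec c \<sigma>)) \<and> Q (mem (exec c \<sigma>)) \<and>
        peak (exec c \<sigma>) \<le> space \<and> steps (exec c \<sigma>) \<le> steps \<sigma> + t)"

lemma triple_conseq:
  assumes "triple P c t Q" "\<And>s. P' s \<Longrightarrow> P s" "t \<le> t'" "\<And>s. Q s \<Longrightarrow> Q' s"
  shows "triple P' c t' Q'"
  using assms unfolding triple_def by (meson add_left_mono order_trans)

lemma triple_time: "triple P c t Q \<Longrightarrow> t \<le> t' \<Longrightarrow> triple P c t' Q"
  by (erule triple_conseq) auto

lemma triple_strengthen: "triple P c t Q \<Longrightarrow> triple (\<lambda>s. P s \<and> R s) c t Q"
  by (erule triple_conseq) auto

lemma triple_ex: "(\<And>v. triple (P v) c t Q) \<Longrightarrow> triple (\<lambda>s. \<exists>v. P v s) c t Q"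
  unfolding triple_def by blast

lemma triple_unreachable: "(\<And>s. P s \<Longrightarrow> False) \<Longrightarrow> triple P c 0 Q"
  by (auto simp: triple_def)

lemma triple_skip: "triple P Skip 1 P"
  by (auto simp: triple_def advance_def store_size_space)

lemma triple_assign:
  assumes "\<And>s. P s \<Longrightarrow> Q (s(x := [eval_exp e s]))" "x \<in> short_names"
  shows "triple P (x ::= e) (exp_time e + 1) Q"
  using assms n_pos by (auto simp: triple_def advance_def intro!: store_size_space fits_upd)

lemma triple_put:
  assumes "\<And>s. P s \<Longrightarrow> Q (s(a := (s a)[index (eval_exp i s) := eval_exp e s]))"
  shows "triple P (a\<lbrakk>i\<rbrakk> ::= e) (exp_time i + exp_time e + 1) Q"
  using assms by (auto simp: triple_def advance_def intro!: store_size_space fits_put)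

lemma triple_alloc:
  assumes "\<And>s. P s \<Longrightarrow> Q (s(a := replicate (index (eval_exp e s)) 0))"
    and "\<And>s. P s \<Longrightarrow> index (eval_exp e s) \<le> N" "N \<le> n" "a \<in> short_names"
  shows "triple P (Alloc a e) (exp_time e + N + 1) Q"
proof -
  have "index (eval_exp e s) \<le> n" if "P s" for s
    using assms(2)[OF that] assms(3) by simp
  then show ?thesis
    using assms by (auto simp: triple_def advance_def intro!: store_size_space fits_upd)
qed

lemma triple_seq:
  assumes "triple P c1 t1 Q" "triple Q c2 t2 R"
  shows "triple P (c1;; c2) (t1 + t2) R"
  unfolding triple_def
proof (intro allI impI)
  fix \<sigma> :: config assume "fits (mem \<sigma>) \<and> P (mem \<sigma>) \<and> peak \<sigma> \<le> space"
  then have 1: "fits (mem (exec c1 \<sigma>)) \<and> Q (mem (exec c1 \<sigma>)) \<and> peak (exec c1 \<sigma>) \<le> space"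
    and t1: "steps (exec c1 \<sigma>) \<le> steps \<sigma> + t1"
    using assms(1) unfolding triple_def by blast+
  then show "fits (mem (exec (c1;; c2) \<sigma>)) \<and> R (mem (exec (c1;; c2) \<sigma>)) \<and>
      peak (exec (c1;; c2) \<sigma>) \<le> space \<and> steps (exec (c1;; c2) \<sigma>) \<le> steps \<sigma> + (t1 + t2)"
    using assms(2) unfolding triple_def by fastforce
qed

lemma triple_cond:
  assumes "triple (\<lambda>s. P s \<and> eval_exp b s \<noteq> 0) c1 t1 Q"
    and "triple (\<lambda>s. P s \<and> eval_exp b s = 0) c2 t2 Q"
  shows "triple P (IF b THEN c1 ELSE c2) (exp_time b + 1 + max t1 t2) Q"
  unfolding triple_def
proof (intro allI impI)
  fix \<sigma> :: config assume *: "fits (mem \<sigma>) \<and> P (mem \<sigma>) \<and> peak \<sigma> \<le> space"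
  define \<rho> where "\<rho> = advance (exp_time b + 1) (mem \<sigma>) \<sigma>"
  have \<rho>: "mem \<rho> = mem \<sigma>" "steps \<rho> = steps \<sigma> + (exp_time b + 1)" "peak \<rho> \<le> space"
    using * by (auto simp: \<rho>_def advance_def store_size_space)
  show "fits (mem (exec (IF b THEN c1 ELSE c2) \<sigma>)) \<and> Q (mem (exec (IF b THEN c1 ELSE c2) \<sigma>)) \<and>
      peak (exec (IF b THEN c1 ELSE c2) \<sigma>) \<le> space \<and>
      steps (exec (IF b THEN c1 ELSE c2) \<sigma>) \<le> steps \<sigma> + (exp_time b + 1 + max t1 t2)"
  proof (cases "eval_exp b (mem \<sigma>) = 0")
    case True
    then have "exec (IF b THEN c1 ELSE c2) \<sigma> = exec c2 \<rho>" by (simp add: \<rho>_def)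
    with True * \<rho> assms(2)[unfolded triple_def, rule_format, of \<rho>] show ?thesis by auto
  next
    case False
    then have "exec (IF b THEN c1 ELSE c2) \<sigma> = exec c1 \<rho>" by (simp add: \<rho>_def)
    with False * \<rho> assms(1)[unfolded triple_def, rule_format, of \<rho>] show ?thesis by auto
  qed
qed

lemma fold_bound:
  fixes t :: "nat \<Rightarrow> nat"
  assumes "\<And>k. k < N \<Longrightarrow> triple (\<lambda>s. I k s \<and> s x = [real k]) c (t k) (I (Suc k))"
    and "\<And>k. k < N \<Longrightarrow> keeps (I k) x" "x \<in> short_names"
    and "fits (mem \<sigma>)" "I 0 (mem \<sigma>)" "peak \<sigma> \<le> space" "j \<le> N"
  defines "g \<equiv> \<lambda>k \<sigma>. exec c (advance 1 ((mem \<sigma>)(x := [real k])) \<sigma>)"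
  defines "r \<equiv> fold g [0..<j] \<sigma>"
  shows "fits (mem r) \<and> I j (mem r) \<and> peak r \<le> space \<and> steps r \<le> steps \<sigma> + (\<Sum>k<j. t k + 1)"
  using \<open>j \<le> N\<close> unfolding r_def
proof (induction j)
  case 0
  then show ?case using assms by simp
next
  case (Suc j)
  let ?r = "fold g [0..<j] \<sigma>"
  have IH: "fits (mem ?r)" "I j (mem ?r)" "peak ?r \<le> space" "steps ?r \<le> steps \<sigma> + (\<Sum>k<j. t k + 1)"
    using Suc.IH Suc.prems by auto
  let ?\<rho> = "advance 1 ((mem ?r)(x := [real j])) ?r"
  have f: "fits (mem ?\<rho>)"
    using IH assms(3) n_pos by (auto simp: advance_def intro!: fits_upd)
  have p: "peak ?\<rho> \<le> space"
    using IH store_size_space[OF f] by (auto simp: advance_def)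
  have I: "I j (mem ?\<rho>) \<and> mem ?\<rho> x = [real j]"
    using assms(2)[of j] IH Suc.prems by (auto simp: advance_def keeps_def)
  have s: "steps ?\<rho> = steps ?r + 1" by (simp add: advance_def)
  have step: "fits (mem (exec c ?\<rho>)) \<and> I (Suc j) (mem (exec c ?\<rho>)) \<and>
      peak (exec c ?\<rho>) \<le> space \<and> steps (exec c ?\<rho>) \<le> steps ?\<rho> + t j"
    using assms(1)[of j, unfolded triple_def, rule_format, of ?\<rho>] Suc.prems f p I by simp
  have eq: "fold g [0..<Suc j] \<sigma> = exec c ?\<rho>"
    by (simp add: g_def)
  have "steps (exec c ?\<rho>) \<le> steps \<sigma> + (\<Sum>k<Suc j. t k + 1)"
    using step s IH(4) unfolding sum.lessThan_Suc by linarith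
  with step show ?case unfolding eq by blast
qed

lemma for_bound:
  assumes "\<And>k. k < N \<Longrightarrow> triple (\<lambda>s. I k s \<and> s x = [real k]) c (t k) (I (Suc k))"
    and "\<And>k. k < N \<Longrightarrow> keeps (I k) x" "x \<in> short_names"
    and "fits (mem \<sigma>)" "I 0 (mem \<sigma>)" "peak \<sigma> \<le> space" "index (eval_exp e (mem \<sigma>)) = N"
  defines "r \<equiv> exec (FOR x BELOW e DO c) \<sigma>"
  shows "fits (mem r) \<and> I N (mem r) \<and> peak r \<le> space \<and>
    steps r \<le> steps \<sigma> + (exp_time e + 1 + (\<Sum>k<N. t k + 1))"
proof -
  define \<rho> where "\<rho> = advance (exp_time e + 1) (mem \<sigma>) \<sigma>"
  have \<rho>: "mem \<rho> = mem \<sigma>" "steps \<rho> = steps \<sigma> + (exp_time e + 1)" "peak \<rho> \<le> space"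
    using assms(4,6) by (auto simp: \<rho>_def advance_def store_size_space)
  have eq: "r = fold (\<lambda>k \<sigma>. exec c (advance 1 ((mem \<sigma>)(x := [real k])) \<sigma>)) [0..<N] \<rho>"
    using assms(7) by (simp add: r_def \<rho>_def)
  have "fits (mem r) \<and> I N (mem r) \<and> peak r \<le> space \<and> steps r \<le> steps \<rho> + (\<Sum>k<N. t k + 1)"
    unfolding eq by (rule fold_bound[where I = I and N = N and t = t, OF assms(1-3)]) (simp_all add: \<rho> assms(4,5))
  with \<rho>(2) show ?thesis by linarith
qed

lemma triple_for:
  assumes "\<And>k. k < N \<Longrightarrow> triple (\<lambda>s. I k s \<and> s x = [real k]) c (t k) (I (Suc k))"
    and "\<And>k. k < N \<Longrightarrow> keeps (I k) x" "x \<in> short_names"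
    and "\<And>s. I 0 s \<Longrightarrow> index (eval_exp e s) = N"
  shows "triple (I 0) (FOR x BELOW e DO c) (exp_time e + 1 + (\<Sum>k<N. t k + 1)) (I N)"
  unfolding triple_def
proof (intro allI impI)
  fix \<sigma> :: config assume *: "fits (mem \<sigma>) \<and> I 0 (mem \<sigma>) \<and> peak \<sigma> \<le> space"
  show "fits (mem (exec (FOR x BELOW e DO c) \<sigma>)) \<and> I N (mem (exec (FOR x BELOW e DO c) \<sigma>)) \<and>
      peak (exec (FOR x BELOW e DO c) \<sigma>) \<le> space \<and>
      steps (exec (FOR x BELOW e DO c) \<sigma>) \<le> steps \<sigma> + (exp_time e + 1 + (\<Sum>k<N. t k + 1))"
    by (rule for_bound[where I = I and N = N and t = t, OF assms(1-3)]) (use * assms(4) in blast)+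
qed

lemma triple_for_inv:
  assumes "\<And>k. k < N \<Longrightarrow> triple (\<lambda>s. P s \<and> s x = [real k]) c t P"
    and "\<And>s. P s \<Longrightarrow> index (eval_exp e s) \<le> N" "keeps P x" "x \<in> short_names"
  shows "triple P (FOR x BELOW e DO c) (exp_time e + 1 + N * (t + 1)) P"
  unfolding triple_def
proof (intro allI impI)
  fix \<sigma> :: config assume *: "fits (mem \<sigma>) \<and> P (mem \<sigma>) \<and> peak \<sigma> \<le> space"
  define M where "M = index (eval_exp e (mem \<sigma>))"
  have M: "M \<le> N" using * assms(2) by (simp add: M_def)
  let ?r = "exec (FOR x BELOW e DO c) \<sigma>"
  have "fits (mem ?r) \<and> P (mem ?r) \<and> peak ?r \<le> space \<and>
      steps ?r \<le> steps \<sigma> + (exp_time e + 1 + (\<Sum>k<M. t + 1))"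
    by (rule for_bound[where I = "\<lambda>_. P" and t = "\<lambda>_. t"])
      (use * assms M in \<open>simp_all only: M_def less_le_trans\<close>)
  moreover have "(\<Sum>k<M. t + 1) \<le> N * (t + 1)"
    using mult_le_mono1[OF M, of "t + 1"] by simp
  ultimately show "fits (mem ?r) \<and> P (mem ?r) \<and> peak ?r \<le> space \<and>
      steps ?r \<le> steps \<sigma> + (exp_time e + 1 + N * (t + 1))"
    by linarith
qed

lemma triple_call:
  assumes "\<And>s. P s \<Longrightarrow> fits s \<Longrightarrow> (case f s of (s', t', w) \<Rightarrow> fits s' \<and> Q s' \<and> t' \<le> t \<and> w \<le> extra)"
  shows "triple P (Call f) (t + 1) Q"
  unfolding triple_def
proof (intro allI impI)
  fix \<sigma> :: config assume *: "fits (mem \<sigma>) \<and> P (mem \<sigma>) \<and> peak \<sigma> \<le> space"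
  obtain s' t' w where f: "f (mem \<sigma>) = (s', t', w)" by (cases "f (mem \<sigma>)")
  with assms[of "mem \<sigma>"] * have "fits s'" "Q s'" "t' \<le> t" "w \<le> extra" by auto
  with f * store_size_le[of s'] store_size_le[of "mem \<sigma>"]
  show "fits (mem (exec (Call f) \<sigma>)) \<and> Q (mem (exec (Call f) \<sigma>)) \<and>
      peak (exec (Call f) \<sigma>) \<le> space \<and> steps (exec (Call f) \<sigma>) \<le> steps \<sigma> + (t + 1)"
    by (auto simp: space_def)
qed

lemma triple_assign_inv: "keeps P x \<Longrightarrow> x \<in> short_names \<Longrightarrow> triple P (x ::= e) (exp_time e + 1) P"
  by (rule triple_assign) (auto intro: keepsD)

lemma triple_put_inv: "keeps P a \<Longrightarrow> triple P (a\<lbrakk>i\<rbrakk> ::= e) (exp_time i + exp_time e + 1) P"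
  by (rule triple_put) (auto intro: keepsD)

lemma triple_alloc_inv:
  assumes "\<And>s. P s \<Longrightarrow> index (eval_exp e s) \<le> N" "N \<le> n" "keeps P a" "a \<in> short_names"
  shows "triple P (Alloc a e) (exp_time e + N + 1) P"
  using assms by (intro triple_alloc) (auto intro: keepsD)

lemma triple_cond_inv:
  "triple P c1 t1 P \<Longrightarrow> triple P c2 t2 P \<Longrightarrow> triple P (IF b THEN c1 ELSE c2) (exp_time b + 1 + max t1 t2) P"
  by (intro triple_cond triple_strengthen)

lemma triple_for_le:
  assumes "triple P c t P" "\<And>s. P s \<Longrightarrow> index (eval_exp e s) \<le> N" "keeps P x" "x \<in> short_names"
  shows "triple P (FOR x BELOW e DO c) (exp_time e + 1 + N * (t + 1)) P"
  using assms by (intro triple_for_inv triple_strengthen)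

lemma triple_for_num:
  assumes "triple P c t P" "keeps P x" "x \<in> short_names"
  shows "triple P (FOR x BELOW num N DO c) (2 + N * (t + 1)) P"
  by (rule triple_time[OF triple_for_le[where N = N and t = t]]) (use assms in simp_all)

lemmas inv_rules = triple_skip triple_assign_inv triple_put_inv triple_seq triple_cond_inv

section \<open>Merge sort\<close>

text \<open>The exponent d is the number of passes that may do work; the remaining ones only test the guard.\<close>

lemma merge_sort_triple:
  assumes P: "\<And>y. y \<in> {''tmp'', ''width'', ''pass'', ''hi'', ''q'', ''li'', ''mid'', ''ri'', a} \<Longrightarrow> keeps P y"
    and a: "a \<in> short_names" "a \<noteq> ''width''"
    and len: "\<And>s. P s \<Longrightarrow> eval_exp len s = real N" "exp_time len = 1"
    and key: "\<And>e. exp_time (key e) \<le> exp_time e + 3"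
    and N: "N \<le> M" "M \<le> n" "M \<le> 2 ^ d"
  shows "triple P (merge_sort_com a len key) (30 + 20 * M + (20 + 80 * M) * d) P"
proof -
  let ?W = "\<lambda>r s. P s \<and> s ''width'' = [r]"
  have kW: "keeps (?W r) y"
    if "y \<in> {''tmp'', ''pass'', ''hi'', ''q'', ''li'', ''mid'', ''ri'', a}" for r y
    using P[of y] that a(2) by (auto simp: keeps_def)
  define A where "A = (IF key (Get a (Var ''li'')) \<preceq> key (Get a (Var ''ri''))
                           THEN (''tmp''\<lbrakk>Var ''q''\<rbrakk> ::= Get a (Var ''li'');; ''li'' ::= Var ''li'' \<oplus> Num 1)
                           ELSE (''tmp''\<lbrakk>Var ''q''\<rbrakk> ::= Get a (Var ''ri'');; ''ri'' ::= Var ''ri'' \<oplus> Num 1))"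
  have A: "triple (?W r) A 25 (?W r)" for r
    unfolding A_def
    apply (rule triple_time)
     apply ((rule inv_rules kW | simp add: short_names_def)+)[1]
    using key[of "Get a (Var ''li'')"] key[of "Get a (Var ''ri'')"] apply simp
    done
  define C where "C = (''hi'' ::= Num 0;;
              FOR ''q'' BELOW len DO
                ((IF Var ''q'' \<doteq> Var ''hi''
                  THEN
                    (''li'' ::= Var ''q'';;
                     ''mid'' ::= min_e (Var ''q'' \<oplus> Var ''width'') len;;
                     ''ri'' ::= Var ''mid'';;
                     ''hi'' ::= min_e (Var ''mid'' \<oplus> Var ''width'') len)
                  ELSE Skip);;
                 (IF Var ''li'' \<prec> Var ''mid''
                  THEN
                    (IF Var ''ri'' \<prec> Var ''hi''
                     THEN A
                     ELSE (''tmp''\<lbrakk>Var ''q''\<rbrakk> ::= Get a (Var ''li'');; ''li'' ::= Var ''li'' \<oplus> Num 1))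
                  ELSE (''tmp''\<lbrakk>Var ''q''\<rbrakk> ::= Get a (Var ''ri'');; ''ri'' ::= Var ''ri'' \<oplus> Num 1)));;
              FOR ''q'' BELOW len DO
                (a\<lbrakk>Var ''q''\<rbrakk> ::= Get ''tmp'' (Var ''q'')))"
  have C: "triple (?W r) C (6 + 75 * M) (?W r)" for r
    unfolding C_def
    apply (rule triple_time)
     apply ((rule A inv_rules kW triple_for_le[where N = M] | simp add: short_names_def len N a)+)[1]
    apply (simp add: len(2))
    done
  define D where "D = (IF Var ''width'' \<prec> len
           THEN (C;; ''width'' ::= Num 2 \<otimes> Var ''width'')
           ELSE Skip)"
  let ?I = "\<lambda>p s. P s \<and> (\<exists>q. s ''width'' = [2 ^ q] \<and> (p = q \<or> N \<le> 2 ^ q))"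
  have D: "triple (\<lambda>s. ?I p s \<and> s ''pass'' = [real p]) D (if p < d then 20 + 75 * M else 5) (?I (Suc p))" for p
  proof -
    let ?t = "if p < d then 20 + 75 * M else 5"
    have "triple (?W (2 ^ q)) D ?t (?I (Suc p))" if q: "p = q \<or> N \<le> 2 ^ q" for q
    proof (cases "N \<le> 2 ^ q")
      case True
      then have T: "real N \<le> 2 ^ q" by (metis of_nat_le_iff of_nat_numeral of_nat_power)
      show ?thesis
        unfolding D_def
        apply (rule triple_time)
         apply (rule triple_cond)
          apply (rule triple_unreachable)
          apply (use T in \<open>auto simp: len read_def split: if_splits\<close>)[1]
         apply (rule triple_conseq[OF triple_skip])
           apply assumption
          apply (rule order_refl)
        using True apply blast
        apply (simp add: len(2))
        done
    next
      case False
      then have F: "2 ^ q < real N" by (metis not_le of_nat_less_iff of_nat_numeral of_nat_power)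
      from False have "p = q" using q by simp
      have "2 ^ q < (2::nat) ^ d" using False N(1,3) by linarith
      with \<open>p = q\<close> have pd: "p < d" by simp
      have dbl: "triple (?W (2 ^ q)) (''width'' ::= Num 2 \<otimes> Var ''width'') 4 (?I (Suc p))"
        apply (rule triple_time, rule triple_assign)
        using P[of "''width''"] \<open>p = q\<close>
        by (auto simp: keeps_def read_def short_names_def intro!: exI[of _ "Suc q"])
      show ?thesis
        unfolding D_def
        apply (rule triple_time)
         apply (rule triple_cond)
          apply (rule triple_strengthen)
          apply (rule triple_seq[OF C dbl])
         apply (rule triple_unreachable)
         apply (use F in \<open>auto simp: len read_def split: if_splits\<close>)[1]
        using pd apply (simp add: len(2))
        done
    qed
    then have "triple (\<lambda>s. ?W (2 ^ q) s \<and> (p = q \<or> N \<le> 2 ^ q)) D ?t (?I (Suc p))" for q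
      by (cases "p = q \<or> N \<le> 2 ^ q") (auto simp: triple_def)
    then have "triple (\<lambda>s. \<exists>q. ?W (2 ^ q) s \<and> (p = q \<or> N \<le> 2 ^ q)) D ?t (?I (Suc p))"
      by (rule triple_ex)
    then show ?thesis
      by (rule triple_conseq) auto
  qed
  have loop: "triple (?I 0) (FOR ''pass'' BELOW len DO D)
      (2 + (\<Sum>p<N. (if p < d then 20 + 75 * M else 5) + 1)) (?I N)"
    apply (rule triple_time)
     apply (rule triple_for[where I = ?I and N = N and x = "''pass''" and t = "\<lambda>p. if p < d then 20 + 75 * M else 5"])
        apply (rule D)
    using P[of "''pass''"] apply (simp add: keeps_def)
    by (simp_all add: short_names_def len)
  have "(\<Sum>p<N. (if p < d then 20 + 75 * M else 5) + 1) \<le> (\<Sum>p<N. (if p < d then 15 + 75 * M else 0) + 6)"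
    by (rule sum_mono) auto
  also have "\<dots> = (\<Sum>p\<in>{..<N} \<inter> {p. p < d}. 15 + 75 * M) + 6 * N"
    by (simp add: sum.distrib sum.If_cases)
  also have "\<dots> \<le> (15 + 75 * M) * d + 6 * M"
  proof -
    have "card ({..<N} \<inter> {p. p < d}) \<le> card {..<d}" by (rule card_mono) auto
    then have "card ({..<N} \<inter> {p. p < d}) * (15 + 75 * M) \<le> (15 + 75 * M) * d"
      by (subst mult.commute) (simp only: card_lessThan mult_le_mono2)
    with N(1) show ?thesis unfolding sum_constant of_nat_id by linarith
  qed
  finally have sum: "(\<Sum>p<N. (if p < d then 20 + 75 * M else 5) + 1) \<le> (15 + 75 * M) * d + 6 * M" .
  have init: "triple P (Alloc ''tmp'' len;; ''width'' ::= Num 1) (1 + M + 1 + (1 + 1)) (?I 0)"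
    apply (rule triple_time)
     apply (rule triple_seq)
      apply (rule triple_alloc_inv[where N = M and P = P])
         apply (simp_all add: len N P short_names_def)
    apply (rule triple_assign)
    using P[of "''width''"] by (auto simp: keeps_def short_names_def intro!: exI[of _ 0])
  have eq: "merge_sort_com a len key =
      Alloc ''tmp'' len;; ''width'' ::= Num 1;; FOR ''pass'' BELOW len DO D"
    by (simp add: merge_sort_com_def D_def C_def A_def Let_def)
  show ?thesis
    unfolding eq
    apply (rule triple_conseq[OF triple_seq[OF init loop]])
    using sum by (auto simp: algebra_simps)
qed

end

section \<open>The phases of the methodology\<close>

lemma read_update:
  "read (s(a := (s a)[i := v])) a k = (if k = i \<and> i < length (s a) then v else read s a k)"
  by (auto simp: read_def)

lemma card_Collect_less_Suc:
  "card {v. v < Suc u \<and> Q v} = card {v. v < u \<and> Q v} + of_bool (Q u)"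
proof -
  have "{v. v < Suc u \<and> Q v} = (if Q u then insert u {v. v < u \<and> Q v} else {v. v < u \<and> Q v})"
    by (auto simp: less_Suc_eq)
  then show ?thesis by simp
qed

lemma ex_doublings:
  assumes "1 \<le> m"
  obtains d where "m \<le> 2 ^ d" "real d \<le> 2 * ln (real m) + 1"
proof
  let ?d = "nat \<lceil>log 2 (real m)\<rceil>"
  have log0: "0 \<le> log 2 (real m)" using assms by simp
  have "log 2 (real m) \<le> real ?d" using log0 by linarith
  then have "2 powr log 2 (real m) \<le> 2 powr real ?d" by (rule powr_mono) simp
  then have "real m \<le> 2 powr real ?d" using assms by simp
  also have "\<dots> = real (2 ^ ?d)" by (simp add: powr_realpow)
  finally show "m \<le> 2 ^ ?d" by (simp only: of_nat_le_iff)
  have "ln (1 / 2 :: real) \<le> 1 / 2 - 1" by (rule ln_le_minus_one) simp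
  then have ln2: "1 / 2 \<le> ln (2 :: real)" by (simp add: ln_div)
  have "log 2 (real m) * (1 / 2) \<le> log 2 (real m) * ln 2" using ln2 log0 by (rule mult_left_mono)
  also have "\<dots> = ln (real m)" by (simp add: log_def)
  finally have "log 2 (real m) \<le> 2 * ln (real m)" by simp
  moreover have "real ?d \<le> log 2 (real m) + 1" using log0 by linarith
  ultimately show "real ?d \<le> 2 * ln (real m) + 1" by simp
qed

locale methodology_run =
  fixes x :: run
  assumes valid: "valid_run x"

sublocale methodology_run \<subseteq> space_bound "n_nodes x" "worst_marginal_space x + louvain_space x"
  using valid by unfold_locales (simp add: valid_run_def bim_instance_def)

context methodology_run
begin

lemma communities: "community x ` nodes x = {..<n_comms x}"
  using valid by (simp add: valid_run_def)

lemma n_comms_pos: "1 \<le> n_comms x"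
proof -
  have "0 \<in> nodes x" using n_pos by (simp add: nodes_def)
  then have "community x 0 \<in> {..<n_comms x}" using communities by blast
  then show ?thesis by simp
qed

lemma n_comms_le: "n_comms x \<le> n_nodes x"
  unfolding n_comms_def using card_image_le[of "nodes x" "community x"] by (simp add: nodes_def)

lemma comm_nodes_le_n_max: "k < n_comms x \<Longrightarrow> card (comm_nodes x k) \<le> n_max x"
  unfolding n_max_def by (rule Max_ge) auto

lemma card_value_le_n_max: "card {v. v < n_nodes x \<and> real (community x v) = r} \<le> n_max x"
proof (cases "{v. v < n_nodes x \<and> real (community x v) = r} = {}")
  case True
  then show ?thesis by (simp only: card.empty)
next
  case False
  then obtain v where v: "v < n_nodes x" "real (community x v) = r" by blast
  then have "community x v < n_comms x" using communities by (auto simp: nodes_def)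
  moreover have "{v. v < n_nodes x \<and> real (community x v) = r} = comm_nodes x (community x v)"
    using v by (auto simp: comm_nodes_def nodes_def)
  ultimately show ?thesis using comm_nodes_le_n_max by simp
qed

lemma card_community_le_n_max: "card {v. v < n_nodes x \<and> community x v = k} \<le> n_max x"
  using card_value_le_n_max[of "real k"] by simp

lemma n_max_pos: "1 \<le> n_max x"
proof -
  have "1 \<le> card {v. v < n_nodes x \<and> community x v = community x 0}"
    using n_pos by (simp add: card_gt_0_iff Suc_le_eq) blast
  then show ?thesis using card_community_le_n_max[of "community x 0"] by linarith
qed

lemma n_max_le: "n_max x \<le> n_nodes x"
proof -
  have "card (comm_nodes x k) \<le> n_nodes x" for k
    using card_mono[of "nodes x" "comm_nodes x k"] by (auto simp: comm_nodes_def nodes_def)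
  moreover have "n_max x \<in> (\<lambda>k. card (comm_nodes x k)) ` {..<n_comms x}"
    unfolding n_max_def using n_comms_pos by (intro Max_in) (auto simp: lessThan_empty_iff)
  ultimately show ?thesis by auto
qed

lemma marginal_time_le:
  "S \<subseteq> nodes x \<Longrightarrow> u \<in> nodes x \<Longrightarrow> marginal_time x S u \<le> worst_marginal_time x"
  unfolding worst_marginal_time_def
  by (rule Max_ge[OF finite_image_set2]) (auto simp: nodes_def)

lemma marginal_space_le:
  "S \<subseteq> nodes x \<Longrightarrow> u \<in> nodes x \<Longrightarrow> marginal_space x S u \<le> worst_marginal_space x"
  unfolding worst_marginal_space_def
  by (rule Max_ge[OF finite_image_set2]) (auto simp: nodes_def)

lemma keeps_True [simp]: "keeps (\<lambda>_. True) a"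
  by (simp add: keeps_def)

lemma bounds_triple: "triple (\<lambda>_. True) (bounds_com x) (100 * (n_nodes x * n_nodes x)) (\<lambda>_. True)"
  unfolding bounds_com_def
  apply (rule triple_time)
   apply ((rule inv_rules triple_for_num triple_alloc_inv[where N = "n_nodes x"] | simp add: short_names_def)+)[1]
  apply (simp add: algebra_simps)
  using n_pos mult_le_mono2[OF n_pos, of "n_nodes x"]
  by (simp only: mult_1_right mult_ac)

lemma marginal_triple:
  assumes "u < n_nodes x"
  shows "triple (\<lambda>s. s ''u'' = [real u])
    (predecessors_com x;;
     Call (marginal_call x);;
     ''T''\<lbrakk>Var ''u''\<rbrakk> ::= Get ''T'' (Var ''u'') \<oplus> Var ''mc'';;
     ''MG''\<lbrakk>Var ''u''\<rbrakk> ::= Get ''T'' (Var ''u'') \<oslash> num (reps x))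
    (60 * n_nodes x + worst_marginal_time x) (\<lambda>_. True)"
proof -
  let ?P = "\<lambda>s::store. s ''u'' = [real u]"
  have keep: "keeps ?P a" if "a \<noteq> ''u''" for a
    using that by (simp add: keeps_def)
  have call: "triple ?P (Call (marginal_call x)) (worst_marginal_time x + 1) ?P"
  proof (rule triple_call)
    fix s assume "?P s" "fits s"
    moreover have "flagged x s ''pre'' \<subseteq> nodes x" by (auto simp: flagged_def)
    ultimately show "case marginal_call x s of (s', t', w) \<Rightarrow> fits s' \<and> ?P s' \<and>
        t' \<le> worst_marginal_time x \<and> w \<le> worst_marginal_space x + louvain_space x"
      using assms n_pos
      by (auto simp: marginal_call_def Let_def read_def nodes_def short_names_def
          intro!: fits_upd marginal_time_le marginal_space_le[THEN trans_le_add1])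
  qed
  show ?thesis
    unfolding predecessors_com_def
    apply (rule triple_conseq[where Q = ?P and P = ?P])
       apply ((rule call inv_rules triple_for_num keep | simp add: short_names_def)+)[1]
    using n_pos by simp_all
qed

lemma shapley_triple:
  "triple (\<lambda>_. True) (shapley_com x)
    (500 * (tau x * reps x * n_nodes x * n_nodes x) + tau x * reps x * n_nodes x * worst_marginal_time x)
    (\<lambda>_. True)"
proof -
  let ?A = "tau x * reps x * n_nodes x * n_nodes x"
  have 1: "1 \<le> tau x" "1 \<le> reps x" using valid by (auto simp: valid_run_def)
  have le: "1 * 1 * 1 * 1 \<le> ?A" "1 * 1 * 1 * n_nodes x \<le> ?A" "1 * 1 * n_nodes x * n_nodes x \<le> ?A"
    "tau x * 1 * 1 * 1 \<le> ?A" "tau x * 1 * 1 * n_nodes x \<le> ?A"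
    "tau x * reps x * 1 * 1 \<le> ?A" "tau x * reps x * 1 * n_nodes x \<le> ?A"
    by (intro mult_le_mono 1 n_pos le_refl)+
  have inner: "triple (\<lambda>_. True)
      (FOR ''u'' BELOW num (n_nodes x) DO
         (predecessors_com x;;
          Call (marginal_call x);;
          ''T''\<lbrakk>Var ''u''\<rbrakk> ::= Get ''T'' (Var ''u'') \<oplus> Var ''mc'';;
          ''MG''\<lbrakk>Var ''u''\<rbrakk> ::= Get ''T'' (Var ''u'') \<oslash> num (reps x)))
      (2 + n_nodes x * (60 * n_nodes x + worst_marginal_time x + 1)) (\<lambda>_. True)"
    by (rule triple_time[OF triple_for_inv[where N = "n_nodes x" and
          t = "60 * n_nodes x + worst_marginal_time x"]])
      (auto simp: short_names_def intro: triple_conseq[OF marginal_triple])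
  show ?thesis
    unfolding shapley_com_def permutation_com_def
    apply (rule triple_time)
     apply ((rule bounds_triple inner inv_rules triple_for_num triple_alloc_inv[where N = "n_nodes x"] | simp add: short_names_def)+)[1]
    apply (simp add: algebra_simps)
    using le by (simp only: mult_1_left mult_1_right mult_ac)
qed

definition detected :: "store \<Rightarrow> bool" where
  "detected s \<longleftrightarrow>
     s ''Community'' = map (\<lambda>u. real (community x u)) [0..<n_nodes x] \<and> s ''l'' = [real (n_comms x)]"

definition sized :: "store \<Rightarrow> bool" where
  "sized s \<longleftrightarrow> detected s \<and> (\<forall>k. read s ''size'' k \<le> real (n_max x))"

lemma keeps_detected: "a \<noteq> ''Community'' \<Longrightarrow> a \<noteq> ''l'' \<Longrightarrow> keeps detected a"
  by (simp add: keeps_def detected_def)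

lemma keeps_sized: "a \<noteq> ''Community'' \<Longrightarrow> a \<noteq> ''l'' \<Longrightarrow> a \<noteq> ''size'' \<Longrightarrow> keeps sized a"
  by (simp add: keeps_def sized_def detected_def read_def)

lemma read_Community:
  "detected s \<Longrightarrow> s ''u'' = [real u] \<Longrightarrow> u < n_nodes x \<Longrightarrow>
     eval_exp (Get ''Community'' (Var ''u'')) s = real (community x u)"
  by (simp add: detected_def read_def)

lemma read_l: "detected s \<Longrightarrow> read s ''l'' 0 = real (n_comms x)"
  by (simp add: detected_def read_def)

lemma sized_detected: "sized s \<Longrightarrow> detected s"
  by (simp add: sized_def)

lemma sized_read_l [simp]: "sized s \<Longrightarrow> read s ''l'' 0 = real (n_comms x)"
  by (simp add: sized_detected read_l)

lemma sized_size: "sized s \<Longrightarrow> index (read s ''size'' k) \<le> n_max x"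
  unfolding sized_def index_def by (metis floor_mono floor_of_nat nat_int nat_mono)

lemma louvain_triple: "triple (\<lambda>_. True) (Call (louvain_call x)) (louvain_time x + 1) detected"
  using n_pos by (intro triple_call)
    (auto simp: louvain_call_def detected_def short_names_def intro!: fits_upd)

lemma sizes_triple:
  "triple (\<lambda>_. True)
    (Call (louvain_call x);;
     Alloc ''size'' (Var ''l'');;
     FOR ''u'' BELOW num (n_nodes x) DO
       (''size''\<lbrakk>Get ''Community'' (Var ''u'')\<rbrakk> ::=
          Get ''size'' (Get ''Community'' (Var ''u'')) \<oplus> Num 1))
    (5 + louvain_time x + n_comms x + 9 * n_nodes x) sized"
proof -
  let ?I = "\<lambda>u s. detected s \<and>
    (\<forall>k. read s ''size'' k \<le> real (card {v. v < u \<and> community x v = k}))"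
  have alloc: "triple detected (Alloc ''size'' (Var ''l'')) (1 + n_comms x + 1) (?I 0)"
    apply (rule triple_time[OF triple_alloc[where N = "n_comms x"]])
        apply (use n_comms_le in \<open>auto simp: read_l short_names_def keepsD[OF keeps_detected] read_def[of "fun_upd _ _ _"]\<close>)
    done
  have body: "triple (\<lambda>s. ?I u s \<and> s ''u'' = [real u])
      (''size''\<lbrakk>Get ''Community'' (Var ''u'')\<rbrakk> ::=
          Get ''size'' (Get ''Community'' (Var ''u'')) \<oplus> Num 1) 8 (?I (Suc u))"
    if u: "u < n_nodes x" for u
  proof (rule triple_time[OF triple_put])
    fix s assume s: "?I u s \<and> s ''u'' = [real u]"
    then have c: "eval_exp (Get ''Community'' (Var ''u'')) s = real (community x u)"
      using u by (intro read_Community) auto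
    then have e: "eval_exp (Get ''size'' (Get ''Community'' (Var ''u'')) \<oplus> Num 1) s =
        read s ''size'' (community x u) + 1"
      by simp
    show "?I (Suc u) (s(''size'' := (s ''size'')
        [index (eval_exp (Get ''Community'' (Var ''u'')) s) :=
         eval_exp (Get ''size'' (Get ''Community'' (Var ''u'')) \<oplus> Num 1) s]))"
      unfolding c e index_real read_update card_Collect_less_Suc
      using s by (auto simp: keepsD[OF keeps_detected] add_increasing2)
  qed simp
  have loop: "triple (?I 0)
      (FOR ''u'' BELOW num (n_nodes x) DO
       (''size''\<lbrakk>Get ''Community'' (Var ''u'')\<rbrakk> ::=
          Get ''size'' (Get ''Community'' (Var ''u'')) \<oplus> Num 1))
      (2 + 9 * n_nodes x) (?I (n_nodes x))"
    apply (rule triple_time[OF triple_for[where I = ?I and N = "n_nodes x" and t = "\<lambda>_. 8"]])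
        apply (rule body)
        apply (auto simp: keeps_def keepsD[OF keeps_detected] read_def short_names_def)
    done
  show ?thesis
  proof (rule triple_conseq[OF triple_seq[OF triple_seq[OF louvain_triple alloc] loop]])
    fix s assume "?I (n_nodes x) s"
    then show "sized s"
      unfolding sized_def using card_community_le_n_max by (meson of_nat_mono order_trans)
  qed auto
qed

lemma communities_triple:
  assumes "n_comms x \<le> 2 ^ d"
  shows "triple (\<lambda>_. True) (communities_com x)
    (louvain_time x + 200 * (n_nodes x * n_comms x) + 100 * (n_comms x * d)) sized"
proof -
  have 1: "n_nodes x * 1 \<le> n_nodes x * n_comms x" "1 * n_comms x \<le> n_nodes x * n_comms x"
    "1 * d \<le> n_comms x * d"
    by (intro mult_le_mono n_pos n_comms_pos le_refl)+
  have sort: "triple sized (merge_sort_com ''ord'' (Var ''l'') (Get ''size''))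
      (30 + 20 * n_comms x + (20 + 80 * n_comms x) * d) sized"
    by (rule merge_sort_triple[where N = "n_comms x"])
      (use assms n_comms_le in \<open>auto simp: short_names_def intro: keeps_sized\<close>)
  show ?thesis
    unfolding communities_com_def
    apply (rule triple_time)
     apply ((rule sizes_triple sort inv_rules triple_alloc_inv[where N = "n_comms x"]
          triple_for_le[where N = "n_comms x"] keeps_sized | simp add: short_names_def n_comms_le)+)[1]
    apply (simp add: algebra_simps)
    using 1 n_pos by (simp only: mult_1_left mult_1_right mult_ac)
qed

lemma budgets_triple: "triple sized (budgets_com x) (100 * (n_nodes x * n_comms x)) sized"
proof -
  have 1: "n_nodes x * 1 \<le> n_nodes x * n_comms x" "1 * n_comms x \<le> n_nodes x * n_comms x"
    by (intro mult_le_mono n_pos n_comms_pos le_refl)+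
  show ?thesis
    unfolding budgets_com_def
    apply (rule triple_time)
     apply ((rule inv_rules triple_alloc_inv[where N = "n_comms x"] triple_for_num
          triple_for_le[where N = "n_comms x"] keeps_sized | simp add: short_names_def n_comms_le)+)[1]
    apply (simp add: algebra_simps)
    using 1 n_pos by (simp only: mult_1_left mult_1_right mult_ac)
qed

definition counted :: "nat \<Rightarrow> store \<Rightarrow> bool" where
  "counted c s \<longleftrightarrow> sized s \<and> s ''cnt'' = [real c] \<and> c \<le> n_max x"

lemma keeps_counted:
  "a \<noteq> ''Community'' \<Longrightarrow> a \<noteq> ''l'' \<Longrightarrow> a \<noteq> ''size'' \<Longrightarrow> a \<noteq> ''cnt'' \<Longrightarrow> keeps (counted c) a"
  using keeps_sized by (auto simp: keeps_def counted_def)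

lemma keeps_ex_counted:
  "a \<noteq> ''Community'' \<Longrightarrow> a \<noteq> ''l'' \<Longrightarrow> a \<noteq> ''size'' \<Longrightarrow> a \<noteq> ''cnt'' \<Longrightarrow>
     keeps (\<lambda>s. \<exists>c. counted c s) a"
  using keeps_counted unfolding keeps_def by blast

lemma counted_index: "\<exists>c. counted c s \<Longrightarrow> index (read s ''cnt'' 0) \<le> n_max x"
  by (auto simp: counted_def read_def)

lemma counting_triple:
  assumes "triple P c t sized"
  shows "triple P
    (c;; ''cnt'' ::= Num 0;;
     FOR ''u'' BELOW num (n_nodes x) DO
       (IF Get ''Community'' (Var ''u'') \<doteq> Var ''k''
        THEN (''L''\<lbrakk>Var ''cnt''\<rbrakk> ::= Var ''u'';; ''cnt'' ::= Var ''cnt'' \<oplus> Num 1)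
        ELSE Skip))
    (t + 4 + 14 * n_nodes x) (\<lambda>s. \<exists>c. counted c s)"
proof -
  let ?I = "\<lambda>u s. sized s \<and>
    s ''cnt'' = [real (card {v. v < u \<and> real (community x v) = read s ''k'' 0})]"
  let ?b = "Get ''Community'' (Var ''u'') \<doteq> Var ''k''"
  let ?then = "''L''\<lbrakk>Var ''cnt''\<rbrakk> ::= Var ''u'';; ''cnt'' ::= Var ''cnt'' \<oplus> Num 1"
  have init: "triple sized (''cnt'' ::= Num 0) 2 (?I 0)"
    by (rule triple_time[OF triple_assign])
      (auto simp: short_names_def read_def intro: keepsD[OF keeps_sized])
  have body: "triple (\<lambda>s. ?I u s \<and> s ''u'' = [real u]) (IF ?b THEN ?then ELSE Skip) 13 (?I (Suc u))"
    if u: "u < n_nodes x" for u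
  proof -
    have b: "eval_exp ?b s = of_bool (real (community x u) = read s ''k'' 0)"
      if "?I u s \<and> s ''u'' = [real u]" for s
      using that u read_Community[of s u] by (simp add: sized_detected)
    let ?P = "\<lambda>s. ?I u s \<and> real (community x u) = read s ''k'' 0"
    have "triple ?P ?then 7 (?I (Suc u))"
      apply (rule triple_time)
       apply (rule triple_seq)
        apply (rule triple_put_inv)
        apply (simp add: keeps_def read_def keepsD[OF keeps_sized])
       apply (rule triple_assign)
        apply (auto simp: card_Collect_less_Suc read_def short_names_def keepsD[OF keeps_sized])
      done
    then have t: "triple (\<lambda>s. (?I u s \<and> s ''u'' = [real u]) \<and> eval_exp ?b s \<noteq> 0) ?then 7 (?I (Suc u))"
      by (rule triple_conseq) (use b in \<open>auto simp del: eval_exp.simps\<close>)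
    have e: "triple (\<lambda>s. (?I u s \<and> s ''u'' = [real u]) \<and> eval_exp ?b s = 0) Skip 1 (?I (Suc u))"
      by (rule triple_conseq[OF triple_skip])
        (use b in \<open>auto simp: card_Collect_less_Suc simp del: eval_exp.simps\<close>)
    show ?thesis
      by (rule triple_time[OF triple_cond[OF t e]]) simp
  qed
  have loop: "triple (?I 0) (FOR ''u'' BELOW num (n_nodes x) DO (IF ?b THEN ?then ELSE Skip))
      (2 + 14 * n_nodes x) (?I (n_nodes x))"
    apply (rule triple_time[OF triple_for[where I = ?I and N = "n_nodes x" and t = "\<lambda>_. 13"]])
        apply (rule body, assumption)
       apply (auto simp: keeps_def keepsD[OF keeps_sized] read_def short_names_def)
    done
  show ?thesis
    by (rule triple_conseq[OF triple_seq[OF triple_seq[OF assms init] loop]])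
      (auto simp: counted_def card_value_le_n_max)
qed

lemma selection_sort_triple:
  assumes "n_max x \<le> 2 ^ d"
  shows "triple (\<lambda>s. \<exists>c. counted c s)
    (merge_sort_com ''L'' (Var ''cnt'') (\<lambda>e. Num 0 \<ominus> Get ''phi'' e))
    (30 + 20 * n_max x + (20 + 80 * n_max x) * d) (\<lambda>s. \<exists>c. counted c s)"
proof (rule triple_ex)
  fix c
  have "triple (counted c) (merge_sort_com ''L'' (Var ''cnt'') (\<lambda>e. Num 0 \<ominus> Get ''phi'' e))
    (30 + 20 * n_max x + (20 + 80 * n_max x) * d) (counted c)"
  proof (cases "c \<le> n_max x")
    case True
    then show ?thesis
      by (intro merge_sort_triple[where N = c])
        (use assms n_max_le in \<open>auto simp: short_names_def counted_def read_def intro: keeps_counted\<close>)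
  next
    case False
    then show ?thesis by (simp add: triple_def counted_def)
  qed
  then show "triple (counted c) (merge_sort_com ''L'' (Var ''cnt'') (\<lambda>e. Num 0 \<ominus> Get ''phi'' e))
    (30 + 20 * n_max x + (20 + 80 * n_max x) * d) (\<lambda>s. \<exists>c. counted c s)"
    by (rule triple_conseq) auto
qed

lemma selection_triple:
  assumes "n_max x \<le> 2 ^ d"
  shows "triple sized (selection_com x)
    (300 * (n_nodes x * n_comms x) + 100 * (n_comms x * n_max x * d)) sized"
proof -
  have 1: "n_nodes x * 1 \<le> n_nodes x * n_comms x" "1 * n_comms x \<le> n_nodes x * n_comms x"
    "n_comms x * n_max x \<le> n_comms x * n_nodes x"
    "n_comms x * 1 * d \<le> n_comms x * n_max x * d"
    by (intro mult_le_mono n_pos n_comms_pos n_max_pos n_max_le le_refl)+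
  have scan: "triple (\<lambda>s. \<exists>c. counted c s)
      (FOR ''j'' BELOW Var ''cnt'' DO
          (''v'' ::= Get ''L'' (Var ''j'');;
           (IF Num 0 \<preceq> Get ''BK'' (Var ''k'')
            THEN
              (IF cost_e x (Var ''v'') \<preceq> Get ''BK'' (Var ''k'')
               THEN
                 (''S''\<lbrakk>Var ''v''\<rbrakk> ::= Num 1;;
                  ''BK''\<lbrakk>Var ''k''\<rbrakk> ::= Get ''BK'' (Var ''k'') \<ominus> cost_e x (Var ''v''))
               ELSE Skip)
            ELSE Skip)))
      (2 + 50 * n_max x) (\<lambda>s. \<exists>c. counted c s)"
    apply (rule triple_time)
     apply ((rule inv_rules triple_for_le[where N = "n_max x"] keeps_ex_counted
          | simp add: short_names_def counted_index)+)[1]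
    apply simp
    done
  have pass_on: "triple (\<lambda>s. \<exists>c. counted c s)
      (''BK''\<lbrakk>Var ''kmax''\<rbrakk> ::= Get ''BK'' (Var ''kmax'') \<oplus> Get ''BK'' (Var ''k'')) 8 sized"
    by (rule triple_time[OF triple_put]) (auto simp: counted_def intro: keepsD[OF keeps_sized])
  show ?thesis
    unfolding selection_com_def
    apply (rule triple_time)
     apply ((rule counting_triple selection_sort_triple[OF assms] scan pass_on inv_rules
          triple_alloc_inv[where N = "n_max x" and a = "''L''"] triple_alloc_inv[where N = "n_nodes x"]
          triple_for_le[where N = "n_comms x"] keeps_sized | simp add: short_names_def n_comms_le n_max_le sized_size)+)[1]
    apply (simp add: algebra_simps)
    using 1 n_pos by (simp only: mult_1_left mult_1_right mult_ac)
qed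

section \<open>Asymptotic bounds\<close>

lemma methodology_triple:
  assumes "n_comms x \<le> 2 ^ d" "n_max x \<le> 2 ^ d'"
  shows "triple (\<lambda>_. True) (methodology x)
    (500 * (tau x * reps x * n_nodes x * n_nodes x) + tau x * reps x * n_nodes x * worst_marginal_time x
     + (louvain_time x + 200 * (n_nodes x * n_comms x) + 100 * (n_comms x * d)
        + 100 * (n_nodes x * n_comms x)
        + (300 * (n_nodes x * n_comms x) + 100 * (n_comms x * n_max x * d')))) sized"
  unfolding methodology_def seed_selection_com_def
  by (rule triple_seq[OF shapley_triple triple_seq[OF triple_seq[OF
        communities_triple[OF assms(1)] budgets_triple] selection_triple[OF assms(2)]]])

lemma initial_bound:
  "triple (\<lambda>_. True) c t Q \<Longrightarrow> running_time c \<le> t \<and> space_used c \<le> space"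
  unfolding triple_def running_time_def space_used_def
  by (drule spec[of _ initial]) (simp add: initial_def fits_def)

lemma space_used_methodology:
  "space_used (methodology x)
     \<le> card short_names * n_nodes x + (worst_marginal_space x + louvain_space x)"
  using initial_bound[OF methodology_triple[of "n_comms x" "n_max x"]]
  by (simp add: space_def less_imp_le)

lemma running_time_methodology:
  "real (running_time (methodology x)) \<le>
     500 * (real (tau x) * real (reps x) * real (n_nodes x) * real (n_nodes x))
     + real (tau x) * real (reps x) * real (n_nodes x) * real (worst_marginal_time x)
     + real (louvain_time x)
     + 800 * (real (n_nodes x) * real (n_comms x))
     + 200 * (real (n_comms x) * ln (real (n_comms x)))
     + 200 * (real (n_comms x) * real (n_max x) * ln (real (n_max x)))"
proof -
  obtain d where d: "n_comms x \<le> 2 ^ d" "real d \<le> 2 * ln (real (n_comms x)) + 1"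
    using ex_doublings[OF n_comms_pos] .
  obtain d' where d': "n_max x \<le> 2 ^ d'" "real d' \<le> 2 * ln (real (n_max x)) + 1"
    using ex_doublings[OF n_max_pos] .
  have "running_time (methodology x) \<le>
     500 * (tau x * reps x * n_nodes x * n_nodes x) + tau x * reps x * n_nodes x * worst_marginal_time x
     + (louvain_time x + 200 * (n_nodes x * n_comms x) + 100 * (n_comms x * d)
        + 100 * (n_nodes x * n_comms x)
        + (300 * (n_nodes x * n_comms x) + 100 * (n_comms x * n_max x * d')))" (is "_ \<le> ?T")
    using initial_bound[OF methodology_triple[OF d(1) d'(1)]] by blast
  then have "real (running_time (methodology x)) \<le> real ?T" by (rule of_nat_mono)
  moreover have "real (n_comms x * d) \<le> 2 * (real (n_comms x) * ln (real (n_comms x))) + real (n_comms x)"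
    using mult_left_mono[OF d(2), of "real (n_comms x)"] by (simp add: algebra_simps)
  moreover have "real (n_comms x * n_max x * d') \<le>
      2 * (real (n_comms x) * real (n_max x) * ln (real (n_max x))) + real (n_comms x) * real (n_max x)"
    using mult_left_mono[OF d'(2), of "real (n_comms x) * real (n_max x)"] by (simp add: algebra_simps)
  moreover have "real (n_comms x) * 1 \<le> real (n_comms x) * real (n_nodes x)"
    using n_pos by (intro mult_left_mono) auto
  moreover have "real (n_comms x) * real (n_max x) \<le> real (n_comms x) * real (n_nodes x)"
    using n_max_le by (intro mult_left_mono) auto
  ultimately show ?thesis by (simp add: algebra_simps)
qed

end

theorem theorem2:
  fixes F :: "run filter"
  assumes "\<forall>\<^sub>F x in F. valid_run x"
    and "(\<lambda>x. real (worst_marginal_time x)) \<in> O[F](\<lambda>x. real (n_arcs x + n_nodes x))"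
    and "(\<lambda>x. real (worst_marginal_space x)) \<in> O[F](\<lambda>x. real (n_nodes x))"
    and "(\<lambda>x. real (louvain_time x)) \<in> O[F](\<lambda>x. real (n_nodes x) * ln (real (n_nodes x)))"
    and "(\<lambda>x. real (louvain_space x)) \<in> O[F](\<lambda>x. real (n_nodes x))"
  shows "(\<lambda>x. real (running_time (methodology x))) \<in> O[F](\<lambda>x.
             real (tau x) * real (n_nodes x) * real (n_arcs x + n_nodes x) * real (reps x)
           + real (n_nodes x) * ln (real (n_nodes x))
           + real (n_comms x) * ln (real (n_comms x))
           + real (n_nodes x) * real (n_comms x)
           + real (n_comms x) * real (n_max x) * ln (real (n_max x)))
       \<and> (\<lambda>x. real (space_used (methodology x))) \<in> O[F](\<lambda>x. real (n_nodes x + n_comms x))"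
proof
  obtain a where a: "a > 0" "\<forall>\<^sub>F x in F. real (worst_marginal_time x) \<le> a * real (n_arcs x + n_nodes x)"
    using assms(2) by (auto elim!: landau_o.bigE)
  obtain b where b: "b > 0" "\<forall>\<^sub>F x in F. norm (real (louvain_time x)) \<le>
      b * norm (real (n_nodes x) * ln (real (n_nodes x)))"
    using assms(4) by (elim landau_o.bigE)
  let ?g = "\<lambda>x. real (tau x) * real (n_nodes x) * real (n_arcs x + n_nodes x) * real (reps x)
           + real (n_nodes x) * ln (real (n_nodes x))
           + real (n_comms x) * ln (real (n_comms x))
           + real (n_nodes x) * real (n_comms x)
           + real (n_comms x) * real (n_max x) * ln (real (n_max x))"
  have "\<forall>\<^sub>F x in F. norm (real (running_time (methodology x))) \<le> (800 + a + b) * norm (?g x)"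
    using assms(1) a(2) b(2)
  proof eventually_elim
    case (elim x)
    then interpret methodology_run x by unfold_locales simp
    let ?X = "real (tau x) * real (n_nodes x) * real (n_arcs x + n_nodes x) * real (reps x)"
    let ?N = "real (n_nodes x) * ln (real (n_nodes x))"
    let ?C = "real (n_comms x) * ln (real (n_comms x))"
    let ?L = "real (n_nodes x) * real (n_comms x)"
    let ?M = "real (n_comms x) * real (n_max x) * ln (real (n_max x))"
    have nonneg: "0 \<le> ?X" "0 \<le> ?N" "0 \<le> ?C" "0 \<le> ?L" "0 \<le> ?M"
      using n_pos n_comms_pos n_max_pos by simp_all
    have "real (tau x) * real (reps x) * real (n_nodes x) * real (n_nodes x)
        \<le> real (tau x) * real (reps x) * real (n_nodes x) * real (n_arcs x + n_nodes x)"
      by (rule mult_left_mono) auto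
    then have 1: "real (tau x) * real (reps x) * real (n_nodes x) * real (n_nodes x) \<le> ?X"
      by (simp only: mult_ac)
    have "real (tau x) * real (reps x) * real (n_nodes x) * real (worst_marginal_time x)
        \<le> real (tau x) * real (reps x) * real (n_nodes x) * (a * real (n_arcs x + n_nodes x))"
      by (rule mult_left_mono[OF elim(2)]) auto
    then have 2: "real (tau x) * real (reps x) * real (n_nodes x) * real (worst_marginal_time x) \<le> a * ?X"
      by (simp only: mult_ac)
    have 3: "real (louvain_time x) \<le> b * ?N"
      using elim(3) nonneg(2) by simp
    have "real (running_time (methodology x)) \<le>
        (500 + a) * ?X + b * ?N + 200 * ?C + 800 * ?L + 200 * ?M"
      using running_time_methodology 1 2 3 unfolding distrib_right by linarith
    also have "\<dots> \<le> (800 + a + b) * ?X + (800 + a + b) * ?N + (800 + a + b) * ?C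
        + (800 + a + b) * ?L + (800 + a + b) * ?M"
      by ((rule add_mono | (rule mult_right_mono, (use a(1) b(1) in linarith), rule nonneg))+)
    also have "\<dots> = (800 + a + b) * ?g x"
      by (simp only: distrib_left)
    finally show ?case using nonneg by simp
  qed
  then show "(\<lambda>x. real (running_time (methodology x))) \<in> O[F](?g)" by (rule landau_o.bigI[rotated]) (use a b in simp)
next
  obtain a where a: "a > 0" "\<forall>\<^sub>F x in F. real (worst_marginal_space x) \<le> a * real (n_nodes x)"
    using assms(3) by (auto elim!: landau_o.bigE)
  obtain b where b: "b > 0" "\<forall>\<^sub>F x in F. real (louvain_space x) \<le> b * real (n_nodes x)"
    using assms(5) by (auto elim!: landau_o.bigE)
  let ?K = "real (card short_names)"
  have "\<forall>\<^sub>F x in F. norm (real (space_used (methodology x))) \<le> (?K + a + b) * norm (real (n_nodes x + n_comms x))"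
    using assms(1) a(2) b(2)
  proof eventually_elim
    case (elim x)
    then interpret methodology_run x by unfold_locales simp
    have "real (space_used (methodology x)) \<le>
        real (card short_names * n_nodes x + (worst_marginal_space x + louvain_space x))"
      using space_used_methodology by (rule of_nat_mono)
    also have "\<dots> \<le> (?K + a + b) * real (n_nodes x)"
      using elim(2,3) by (simp add: algebra_simps)
    also have "\<dots> \<le> (?K + a + b) * real (n_nodes x + n_comms x)"
      using a(1) b(1) by (intro mult_left_mono) auto
    finally show ?case by simp
  qed
  then show "(\<lambda>x. real (space_used (methodology x))) \<in> O[F](\<lambda>x. real (n_nodes x + n_comms x))"
    by (rule landau_o.bigI[rotated]) (use a b in \<open>simp add: add_nonneg_pos\<close>)
qed

end
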